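(* Given the representation of the Clifford algebra $Cl(2n)$ defined by $$\Gamma_j=\sigma_1^{\otimes (j-1)}\otimes\sigma_2\otimes I^{\otimes (n-j)},\qquad \Gamma_{n+j}=\sigma_1^{\otimes (j-1)}\otimes\sigma_3\otimes I^{\otimes (n-j)},\qquad 1\le j\le n,$$ there is an eigenvector $|\Gamma_j\rangle$ of $\Gamma_j$ orthogonal to the vector $\Gamma_i\Gamma_j|\Gamma_j\rangle$, with $i\ne j$. The eigenvectors of $\Gamma_j$ and $\Gamma_{n+j}$ are given explicitly by $$\left(\tfrac{1}{\sqrt 2}\right)^{j-1}\begin{pmatrix}1\\ \pm1\end{pmatrix}^{\otimes (j-1)}\otimes\begin{pmatrix}1\\ \pm i\end{pmatrix}\otimes\begin{pmatrix}1\\0\end{pmatrix}^{\otimes (n-j)}$$ and $$\left(\tfrac{1}{\sqrt 2}\right)^{j-1}\begin{pmatrix}1\\ \pm1\end{pmatrix}^{\otimes (j-1)}\otimes\begin{pmatrix}1\\0\end{pmatrix}^{\otimes (n-j+1)},$$ respectively, with eigenvalues $\pm1$.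
   Context: The Pauli matrices are $\sigma_1=\begin{pmatrix}0&1\\1&0\end{pmatrix}$, $\sigma_2=\begin{pmatrix}0&-i\\i&0\end{pmatrix}$, $\sigma_3=\begin{pmatrix}1&0\\0&-1\end{pmatrix}$, and $I$ is the $2\times2$ identity matrix. The operators $\Gamma_1,\dots,\Gamma_{2n}$ act on $(\mathbb{C}^2)^{\otimes n}$ and satisfy the Clifford relations $\Gamma_a\Gamma_b+\Gamma_b\Gamma_a=2\delta_{ab}$ times the identity. In the column vector $\begin{pmatrix}1\\ \pm i\end{pmatrix}$ the symbol $i$ is the imaginary unit; in $\Gamma_i$ it is an index. Orthogonality is with respect to the standard Hermitian inner product on $(\mathbb{C}^2)^{\otimes n}$, and $v^{\otimes k}$ is the $k$-fold tensor power.
   Formalization: The eigenvalues are not ±1 matching the signs in the vectors: with sign s in (1,±1) and independent sign t in (1,±i) they are s^(j-1)t for Γ_j and s^(j-1) for Γ_{n+j}; for odd j the second family has only eigenvalue +1. These exact values are stated. *)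

theory Defs
  imports Complex_Main "Jordan_Normal_Form.Matrix" "Jordan_Normal_Form.Char_Poly"
begin

text \<open>
  The space $({\bf C}^2)^{\otimes n}$ is represented by complex vectors of dimension $2^n$ in the
  lexicographically ordered product basis, so that tensor products become Kronecker products
  (the left factor carries the most significant part of the index).
\<close>

definition kron :: "'a :: comm_ring_1 mat \<Rightarrow> 'a mat \<Rightarrow> 'a mat" where
  "kron A B = mat (dim_row A * dim_row B) (dim_col A * dim_col B)
     (\<lambda>(i, j). A $$ (i div dim_row B, j div dim_col B) * B $$ (i mod dim_row B, j mod dim_col B))"

definition kron_vec :: "'a :: comm_ring_1 vec \<Rightarrow> 'a vec \<Rightarrow> 'a vec" where
  "kron_vec v w = vec (dim_vec v * dim_vec w)
     (\<lambda>i. v $ (i div dim_vec w) * w $ (i mod dim_vec w))"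

fun kron_pow :: "'a :: comm_ring_1 mat \<Rightarrow> nat \<Rightarrow> 'a mat" where
  "kron_pow A 0 = 1\<^sub>m 1"
| "kron_pow A (Suc k) = kron A (kron_pow A k)"

fun kron_vec_pow :: "'a :: comm_ring_1 vec \<Rightarrow> nat \<Rightarrow> 'a vec" where
  "kron_vec_pow v 0 = vec_of_list [1]"
| "kron_vec_pow v (Suc k) = kron_vec v (kron_vec_pow v k)"

definition pauli1 :: "complex mat" where
  "pauli1 = mat_of_rows_list 2 [[0, 1], [1, 0]]"

definition pauli2 :: "complex mat" where
  "pauli2 = mat_of_rows_list 2 [[0, - \<i>], [\<i>, 0]]"

definition pauli3 :: "complex mat" where
  "pauli3 = mat_of_rows_list 2 [[1, 0], [0, - 1]]"

definition pauli_string :: "nat \<Rightarrow> nat \<Rightarrow> complex mat \<Rightarrow> complex mat" where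
  "pauli_string n j S = kron (kron_pow pauli1 (j - 1)) (kron S (kron_pow (1\<^sub>m 2) (n - j)))"

text \<open>Only the indices \<open>1 \<le> a \<le> 2 * n\<close> are meaningful.\<close>

definition Gamma :: "nat \<Rightarrow> nat \<Rightarrow> complex mat" where
  "Gamma n a = (if a \<le> n then pauli_string n a pauli2 else pauli_string n (a - n) pauli3)"

text \<open>
  The sign \<open>s\<close> is the one in the tensor power of $(1, \pm 1)$, common to all of its factors;
  \<open>t\<close> is the sign in $(1, \pm i)$.
\<close>

definition eigvec_pauli2 :: "nat \<Rightarrow> nat \<Rightarrow> complex \<Rightarrow> complex \<Rightarrow> complex vec" where
  "eigvec_pauli2 n j s t = (complex_of_real (1 / sqrt 2)) ^ (j - 1) \<cdot>\<^sub>v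
     kron_vec (kron_vec_pow (vec_of_list [1, s]) (j - 1))
       (kron_vec (vec_of_list [1, t * \<i>]) (kron_vec_pow (vec_of_list [1, 0]) (n - j)))"

definition eigvec_pauli3 :: "nat \<Rightarrow> nat \<Rightarrow> complex \<Rightarrow> complex vec" where
  "eigvec_pauli3 n j s = (complex_of_real (1 / sqrt 2)) ^ (j - 1) \<cdot>\<^sub>v
     kron_vec (kron_vec_pow (vec_of_list [1, s]) (j - 1))
       (kron_vec_pow (vec_of_list [1, 0]) (n - j + 1))"

lemma dim_kron [simp]:
  "dim_row (kron A B) = dim_row A * dim_row B" "dim_col (kron A B) = dim_col A * dim_col B"
  by (simp_all add: kron_def)

lemma dim_kron_pow [simp]:
  "dim_row (kron_pow A k) = dim_row A ^ k" "dim_col (kron_pow A k) = dim_col A ^ k"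
  by (induction k) simp_all

lemma Gamma_carrier:
  assumes "a \<in> {1..2 * n}"
  shows "Gamma n a \<in> carrier_mat (2 ^ n) (2 ^ n)"
proof -
  have *: "pauli_string n j S \<in> carrier_mat (2 ^ n) (2 ^ n)"
    if "j \<in> {1..n}" "S \<in> carrier_mat 2 2" for j S
  proof -
    have "n = (j - 1) + Suc (n - j)" using that by auto
    then have "(2::nat) ^ n = 2 ^ (j - 1) * (2 * 2 ^ (n - j))"
      by (metis power_Suc power_add)
    then show ?thesis using that
      by (auto simp: pauli_string_def pauli1_def mat_of_rows_list_def numeral_2_eq_2 intro!: carrier_matI)
  qed
  have "pauli2 \<in> carrier_mat 2 2" "pauli3 \<in> carrier_mat 2 2"
    by (auto simp: pauli2_def pauli3_def mat_of_rows_list_def)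
  with assms show ?thesis by (auto simp: Gamma_def intro!: *)
qed

end

theory Submission
  imports Defs
begin

text \<open>
  If \<open>G\<close> is Hermitian with \<open>G v = k v\<close>, \<open>k\<close> real, and \<open>H\<close> anticommutes with \<open>G\<close>, then
  \<open>k \<langle>H v, v\<rangle> = \<langle>H G v, v\<rangle> = - \<langle>H v, G v\<rangle> = - k \<langle>H v, v\<rangle>\<close>, so \<open>\<langle>H G v, v\<rangle> = 0\<close>. Hence every eigenvector of
  \<open>\<Gamma>\<^sub>j\<close> has the required orthogonality property; that distinct \<open>\<Gamma>\<close>'s anticommute follows by peeling off the first tensor
  factor. That the given vectors are eigenvectors
  is read off factor by factor, and they are nonzero because each factor has first coordinate 1.
\<close>

section \<open>Kronecker products\<close>

lemma index_kron:
  assumes "i < dim_row A * dim_row B" "j < dim_col A * dim_col B"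
  shows "kron A B $$ (i, j)
    = A $$ (i div dim_row B, j div dim_col B) * B $$ (i mod dim_row B, j mod dim_col B)"
  using assms by (simp add: kron_def)

lemma div_mod_less_of_less_mult:
  fixes i m n :: nat
  assumes "i < m * n"
  shows "i div n < m" "i mod n < n"
proof -
  have "n > 0" using assms by (cases n) auto
  then show "i div n < m" "i mod n < n"
    using assms by (auto simp: less_mult_imp_div_less)
qed

lemma kron_carrier_mat [intro]:
  assumes "A \<in> carrier_mat a b" "B \<in> carrier_mat c d"
  shows "kron A B \<in> carrier_mat (a * c) (b * d)"
  using assms by auto

lemma dim_kron_vec [simp]: "dim_vec (kron_vec v w) = dim_vec v * dim_vec w"
  by (simp add: kron_vec_def)

lemma dim_kron_vec_pow [simp]: "dim_vec (kron_vec_pow v k) = dim_vec v ^ k"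
  by (induction k) simp_all

lemma kron_vec_carrier_vec [intro]:
  assumes "v \<in> carrier_vec a" "w \<in> carrier_vec b"
  shows "kron_vec v w \<in> carrier_vec (a * b)"
  using assms by (intro carrier_vecI) auto

lemma kron_vec_pow_carrier_vec [intro]:
  assumes "v \<in> carrier_vec a"
  shows "kron_vec_pow v k \<in> carrier_vec (a ^ k)"
  using assms by (intro carrier_vecI) auto

text \<open>Cut the range into \<open>n\<close> blocks of length \<open>q\<close>: on block
  \<open>m\<close> the quotient is constantly \<open>m\<close> and the remainder runs through all of
  \<open>0..<q\<close>. This is how sums over a product basis split into a product of sums.\<close>

lemma sum_div_times_mod:
  fixes f g :: "nat \<Rightarrow> 'a :: comm_semiring_1"
  shows "(\<Sum>k = 0..<n * q. f (k div q) * g (k mod q)) = (\<Sum>i = 0..<n. f i) * (\<Sum>j = 0..<q. g j)"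
proof -
  have "(\<Sum>k = m * q..<m * q + q. f (k div q) * g (k mod q)) = f m * (\<Sum>j = 0..<q. g j)" for m
  proof -
    have "(\<Sum>k = m * q..<m * q + q. f (k div q) * g (k mod q))
        = (\<Sum>j = 0..<q. f ((j + m * q) div q) * g ((j + m * q) mod q))"
      using sum.shift_bounds_nat_ivl[of "\<lambda>k. f (k div q) * g (k mod q)" 0 "m * q" q]
      by (simp add: add.commute)
    also have "\<dots> = (\<Sum>j = 0..<q. f m * g j)"
      by (rule sum.cong) auto
    finally show ?thesis by (simp add: sum_distrib_left)
  qed
  then have "(\<Sum>m<n. \<Sum>k = m * q..<m * q + q. f (k div q) * g (k mod q))
      = (\<Sum>i = 0..<n. f i) * (\<Sum>j = 0..<q. g j)"
    by (simp add: sum_distrib_right atLeast0LessThan)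
  then show ?thesis by (simp add: sum.nat_group atLeast0LessThan)
qed

text \<open>The mixed-product rule. In each entry the summand separates into a factor depending on
  \<open>k div d\<close> and one depending on \<open>k mod d\<close>, so
  \<open>sum_div_times_mod\<close> applies.\<close>

lemma kron_mult_kron:
  assumes "A \<in> carrier_mat a b" "B \<in> carrier_mat c d" "C \<in> carrier_mat b e" "D \<in> carrier_mat d f"
  shows "kron A B * kron C D = kron (A * C) (B * D)"
proof (rule eq_matI)
  fix i j assume "i < dim_row (kron (A * C) (B * D))" "j < dim_col (kron (A * C) (B * D))"
  then have i: "i < a * c" and j: "j < e * f" using assms by auto
  note ij = div_mod_less_of_less_mult[OF i] div_mod_less_of_less_mult[OF j]
  have "(kron A B * kron C D) $$ (i, j)
      = (\<Sum>k = 0..<b * d. (A $$ (i div c, k div d) * C $$ (k div d, j div f))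
          * (B $$ (i mod c, k mod d) * D $$ (k mod d, j mod f)))"
    using assms i j by (auto simp: scalar_prod_def index_kron ac_simps intro!: sum.cong)
  also have "\<dots> = (\<Sum>k = 0..<b. A $$ (i div c, k) * C $$ (k, j div f))
      * (\<Sum>k = 0..<d. B $$ (i mod c, k) * D $$ (k, j mod f))"
    by (rule sum_div_times_mod)
  also have "\<dots> = kron (A * C) (B * D) $$ (i, j)"
    using assms i j ij by (auto simp: scalar_prod_def index_kron)
  finally show "(kron A B * kron C D) $$ (i, j) = kron (A * C) (B * D) $$ (i, j)" .
qed (use assms in auto)

lemma kron_mult_kron_vec:
  assumes "A \<in> carrier_mat a b" "B \<in> carrier_mat c d" "v \<in> carrier_vec b" "w \<in> carrier_vec d"
  shows "kron A B *\<^sub>v kron_vec v w = kron_vec (A *\<^sub>v v) (B *\<^sub>v w)"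
proof (rule eq_vecI)
  fix i assume "i < dim_vec (kron_vec (A *\<^sub>v v) (B *\<^sub>v w))"
  then have i: "i < a * c" using assms by auto
  note ic = div_mod_less_of_less_mult[OF i]
  have "(kron A B *\<^sub>v kron_vec v w) $ i
      = (\<Sum>k = 0..<b * d. (A $$ (i div c, k div d) * v $ (k div d))
          * (B $$ (i mod c, k mod d) * w $ (k mod d)))"
    using assms i by (auto simp: scalar_prod_def index_kron kron_vec_def ac_simps intro!: sum.cong)
  also have "\<dots> = (\<Sum>k = 0..<b. A $$ (i div c, k) * v $ k) * (\<Sum>k = 0..<d. B $$ (i mod c, k) * w $ k)"
    by (rule sum_div_times_mod)
  also have "\<dots> = kron_vec (A *\<^sub>v v) (B *\<^sub>v w) $ i"
    using assms i ic by (auto simp: scalar_prod_def kron_vec_def)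
  finally show "(kron A B *\<^sub>v kron_vec v w) $ i = kron_vec (A *\<^sub>v v) (B *\<^sub>v w) $ i" .
qed (use assms in auto)

text \<open>Both sides read off the same three mixed-radix digits of the row and column indices. It
  lets the leading factor of \<open>kron_pow pauli1\<close> be split off a Pauli string.\<close>

lemma kron_assoc: "kron (kron A B) C = kron A (kron B C)"
proof (rule eq_matI)
  fix i j assume "i < dim_row (kron A (kron B C))" "j < dim_col (kron A (kron B C))"
  then have i: "i < dim_row A * dim_row B * dim_row C" and j: "j < dim_col A * dim_col B * dim_col C"
    by (auto simp: ac_simps)
  then have i': "i < dim_row A * (dim_row B * dim_row C)" and j': "j < dim_col A * (dim_col B * dim_col C)"
    by (auto simp: ac_simps)
  \<comment> \<open>These identities say that the digits of \<open>k\<close> with respect to the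
    radices \<open>m\<close> and \<open>l\<close> do not depend on the order in which they are
    extracted.\<close>
  have mod_div: "k mod (m * l) div l = k div l mod m" "k mod (m * l) mod l = k mod l"
    "k div (m * l) = k div l div m" if "k < x * m * l" for k l m x :: nat
  proof -
    have l: "l > 0" using that by (cases l) auto
    have "k mod (m * l) = l * (k div l mod m) + k mod l" "k div (m * l) = k div l div m"
      using mod_mult2_eq[of k l m] div_mult2_eq[of k l m] by (simp_all only: mult.commute[of m l])
    then show "k mod (m * l) div l = k div l mod m" "k mod (m * l) mod l = k mod l"
      "k div (m * l) = k div l div m"
      using l by auto
  qed
  show "kron (kron A B) C $$ (i, j) = kron A (kron B C) $$ (i, j)"
    using i j i' j' div_mod_less_of_less_mult[OF i] div_mod_less_of_less_mult[OF j]
      div_mod_less_of_less_mult[OF i'] div_mod_less_of_less_mult[OF j']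
    by (simp add: index_kron mod_div[OF i] mod_div[OF j] mult.assoc)
qed (auto simp: ac_simps)

lemma kron_uminus_left: "kron (- A) B = - kron A B"
proof (rule eq_matI)
  fix i j assume "i < dim_row (- kron A B)" "j < dim_col (- kron A B)"
  then have "i < dim_row A * dim_row B" "j < dim_col A * dim_col B" by auto
  then show "kron (- A) B $$ (i, j) = (- kron A B) $$ (i, j)"
    by (auto simp: index_kron div_mod_less_of_less_mult)
qed auto

lemma kron_uminus_right: "kron A (- B) = - kron A B"
proof (rule eq_matI)
  fix i j assume "i < dim_row (- kron A B)" "j < dim_col (- kron A B)"
  then have "i < dim_row A * dim_row B" "j < dim_col A * dim_col B" by auto
  then show "kron A (- B) $$ (i, j) = (- kron A B) $$ (i, j)"
    by (auto simp: index_kron div_mod_less_of_less_mult)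
qed auto

lemma kron_one_left: "kron (1\<^sub>m 1) A = A"
  by (rule eq_matI) (auto simp: index_kron)

lemma kron_one_one: "kron (1\<^sub>m a) (1\<^sub>m b) = 1\<^sub>m (a * b)"
proof (rule eq_matI)
  fix i j assume "i < dim_row (1\<^sub>m (a * b) :: 'a mat)" "j < dim_col (1\<^sub>m (a * b) :: 'a mat)"
  then have i: "i < a * b" and j: "j < a * b" by auto
  \<comment> \<open>An index is determined by its quotient and remainder, so the product of the two
    Kronecker deltas is a single delta.\<close>
  have "i div b = j div b \<and> i mod b = j mod b \<longleftrightarrow> i = j" by (metis div_mult_mod_eq)
  then show "kron (1\<^sub>m a) (1\<^sub>m b) $$ (i, j) = (1\<^sub>m (a * b) :: 'a mat) $$ (i, j)"
    using i j div_mod_less_of_less_mult[OF i] div_mod_less_of_less_mult[OF j]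
    by (auto simp: index_kron)
qed auto

lemma kron_pow_one: "kron_pow (1\<^sub>m a) k = 1\<^sub>m (a ^ k)"
  by (induction k) (simp_all add: kron_one_one)

lemma kron_vec_smult_left: "kron_vec (k \<cdot>\<^sub>v v) w = k \<cdot>\<^sub>v kron_vec v w"
  by (rule eq_vecI) (auto simp: kron_vec_def div_mod_less_of_less_mult mult.assoc)

lemma kron_vec_smult_right: "kron_vec v (k \<cdot>\<^sub>v w) = k \<cdot>\<^sub>v kron_vec v w"
  by (rule eq_vecI) (auto simp: kron_vec_def div_mod_less_of_less_mult mult.left_commute)

text \<open>By the mixed-product rule each tensor factor contributes one eigenvalue
  \<open>s\<close>, and scalars move freely through \<open>kron_vec\<close>.\<close>

lemma kron_pow_mult_kron_vec_pow:
  assumes "A \<in> carrier_mat a a" "v \<in> carrier_vec a" "A *\<^sub>v v = s \<cdot>\<^sub>v v"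
  shows "kron_pow A k *\<^sub>v kron_vec_pow v k = s ^ k \<cdot>\<^sub>v kron_vec_pow v k"
proof (induction k)
  case 0
  show ?case by (auto intro!: eq_vecI simp: scalar_prod_def)
next
  case (Suc k)
  have "kron_pow A k \<in> carrier_mat (a ^ k) (a ^ k)" "kron_vec_pow v k \<in> carrier_vec (a ^ k)"
    using assms by auto
  then have "kron_pow A (Suc k) *\<^sub>v kron_vec_pow v (Suc k)
      = kron_vec (s \<cdot>\<^sub>v v) (s ^ k \<cdot>\<^sub>v kron_vec_pow v k)"
    using kron_mult_kron_vec[of A a a] assms Suc.IH by simp
  then show ?case
    by (simp add: kron_vec_smult_left kron_vec_smult_right smult_smult_assoc mult.commute[of s])
qed

text \<open>Coordinate 0 is multiplicative under tensor products; this is used to see that the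
  explicit eigenvectors are nonzero.\<close>

lemma kron_vec_index_0:
  assumes "dim_vec v > 0" "dim_vec w > 0"
  shows "kron_vec v w $ 0 = v $ 0 * w $ 0"
  using assms by (simp add: kron_vec_def)

lemma kron_vec_pow_index_0:
  assumes "dim_vec v > 0"
  shows "kron_vec_pow v k $ 0 = (v $ 0) ^ k"
  using assms by (induction k) (simp_all add: kron_vec_index_0)

section \<open>Hermitian matrices\<close>

definition hermitian :: "complex mat \<Rightarrow> bool" where
  "hermitian A \<longleftrightarrow> map_mat cnj (transpose_mat A) = A"

text \<open>Conjugate transposition acts on each Kronecker factor separately.\<close>

lemma hermitian_kron:
  assumes "hermitian A" "hermitian B"
  shows "hermitian (kron A B)"
proof -
  have "map_mat cnj (transpose_mat (kron A B))
      = kron (map_mat cnj (transpose_mat A)) (map_mat cnj (transpose_mat B))"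
    by (rule eq_matI) (auto simp: index_kron div_mod_less_of_less_mult)
  then show ?thesis using assms by (simp add: hermitian_def)
qed

lemma hermitian_one: "hermitian (1\<^sub>m k)"
  unfolding hermitian_def by (rule eq_matI) auto

lemma hermitian_kron_pow: "hermitian A \<Longrightarrow> hermitian (kron_pow A k)"
  by (induction k) (auto simp: hermitian_kron hermitian_one)

text \<open>The matrix is moved across the bilinear product as a transpose; acting on the conjugated
  vector, this transpose is the conjugate of the adjoint acting on \<open>w\<close>, and the adjoint
  is \<open>A\<close>.\<close>

lemma hermitian_cscalar_prod:
  assumes "A \<in> carrier_mat n n" "hermitian A" "v \<in> carrier_vec n" "w \<in> carrier_vec n"
  shows "(A *\<^sub>v v) \<bullet>c w = v \<bullet>c (A *\<^sub>v w)"
proof -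
  have "transpose_mat A *\<^sub>v conjugate w = conjugate (map_mat cnj (transpose_mat A) *\<^sub>v w)"
    using assms by (intro eq_vecI) (auto simp: scalar_prod_def)
  then have *: "transpose_mat A *\<^sub>v conjugate w = conjugate (A *\<^sub>v w)"
    using assms(2) by (simp add: hermitian_def)
  have "(A *\<^sub>v v) \<bullet>c w = conjugate w \<bullet> (A *\<^sub>v v)"
    using assms by (intro comm_scalar_prod[of _ n]) auto
  also have "\<dots> = (transpose_mat A *\<^sub>v conjugate w) \<bullet> v"
    using assms by (intro transpose_vec_mult_scalar[symmetric]) auto
  also have "\<dots> = v \<bullet>c (A *\<^sub>v w)"
    unfolding * using assms by (intro comm_scalar_prod[of _ n]) auto
  finally show ?thesis .
qed

lemma anticommuting_hermitian_orthogonal: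
  assumes A: "A \<in> carrier_mat n n" "hermitian A" and B: "B \<in> carrier_mat n n"
    and anti: "B * A = - (A * B)"
    and ev: "eigenvector A v k" and k: "cnj k = k"
  shows "((B * A) *\<^sub>v v) \<bullet>c v = 0"
proof -
  have v: "v \<in> carrier_vec n" and Av: "A *\<^sub>v v = k \<cdot>\<^sub>v v"
    using ev A by (auto simp: eigenvector_def)
  have Bv: "B *\<^sub>v v \<in> carrier_vec n" using B v by auto
  have "(B * A) *\<^sub>v v = B *\<^sub>v (A *\<^sub>v v)" using A B v by simp
  also have "\<dots> = k \<cdot>\<^sub>v (B *\<^sub>v v)" using B v by (simp add: Av mult_mat_vec)
  finally have "((B * A) *\<^sub>v v) \<bullet>c v = k * ((B *\<^sub>v v) \<bullet>c v)"
    using B v by simp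
  moreover have "((B * A) *\<^sub>v v) \<bullet>c v = - (k * ((B *\<^sub>v v) \<bullet>c v))"
  proof -
    have "(B * A) *\<^sub>v v = - ((A * B) *\<^sub>v v)" using A B v by (simp add: anti)
    also have "\<dots> = - (A *\<^sub>v (B *\<^sub>v v))" using A B v by simp
    finally have "((B * A) *\<^sub>v v) \<bullet>c v = - ((A *\<^sub>v (B *\<^sub>v v)) \<bullet>c v)"
      using A B v by simp
    also have "(A *\<^sub>v (B *\<^sub>v v)) \<bullet>c v = (B *\<^sub>v v) \<bullet>c (k \<cdot>\<^sub>v v)"
      using hermitian_cscalar_prod[OF A Bv v] by (simp add: Av)
    \<comment> \<open>The product \<open>\<bullet>c\<close> conjugates its second argument, so the
      scalar comes out as \<open>cnj k\<close>, which is \<open>k\<close> because the eigenvalue is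
      real.\<close>
    also have "\<dots> = k * ((B *\<^sub>v v) \<bullet>c v)"
      using B v k by (simp add: conjugate_smult_vec)
    finally show ?thesis .
  qed
  \<comment> \<open>The product equals its own negative, so it vanishes without any division by
    \<open>k\<close>.\<close>
  ultimately show ?thesis by simp
qed

section \<open>The Clifford generators\<close>

lemma pauli_carrier_mat [simp]:
  "pauli1 \<in> carrier_mat 2 2" "pauli2 \<in> carrier_mat 2 2" "pauli3 \<in> carrier_mat 2 2"
  by (auto simp: pauli1_def pauli2_def pauli3_def mat_of_rows_list_def)

lemma dim_pauli [simp]:
  "dim_row pauli1 = 2" "dim_col pauli1 = 2" "dim_row pauli2 = 2" "dim_col pauli2 = 2"
  "dim_row pauli3 = 2" "dim_col pauli3 = 2"
  using pauli_carrier_mat[THEN carrier_matD(1)] pauli_carrier_mat[THEN carrier_matD(2)] by auto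

lemma index_pauli [simp]:
  "pauli1 $$ (0, 0) = 0" "pauli1 $$ (0, Suc 0) = 1" "pauli1 $$ (Suc 0, 0) = 1" "pauli1 $$ (Suc 0, Suc 0) = 0"
  "pauli2 $$ (0, 0) = 0" "pauli2 $$ (0, Suc 0) = - \<i>" "pauli2 $$ (Suc 0, 0) = \<i>" "pauli2 $$ (Suc 0, Suc 0) = 0"
  "pauli3 $$ (0, 0) = 1" "pauli3 $$ (0, Suc 0) = 0" "pauli3 $$ (Suc 0, 0) = 0" "pauli3 $$ (Suc 0, Suc 0) = - 1"
  by (simp_all add: pauli1_def pauli2_def pauli3_def mat_of_rows_list_def)

lemma sum_atLeast0_lessThan_2: "sum f {0..<2} = f 0 + f (Suc 0)" for f :: "nat \<Rightarrow> 'a :: comm_monoid_add"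
  by (simp add: numeral_2_eq_2)

lemma vec_of_list_pair_carrier_vec: "vec_of_list [x, y] \<in> carrier_vec 2"
  by (rule carrier_vecI) simp

lemma hermitian_pauli: "hermitian pauli1" "hermitian pauli2" "hermitian pauli3"
  unfolding hermitian_def by (rule eq_matI; force dest!: less_2_cases)+

lemma pauli_anticommute:
  "pauli2 * pauli1 = - (pauli1 * pauli2)"
  "pauli3 * pauli1 = - (pauli1 * pauli3)"
  "pauli2 * pauli3 = - (pauli3 * pauli2)"
  by (rule eq_matI; force simp: scalar_prod_def sum_atLeast0_lessThan_2 dest!: less_2_cases)+

text \<open>For \<open>pauli1\<close> and \<open>pauli2\<close> the second coordinate agrees because
  the sign squares to 1.\<close>

lemma pauli_mult_vec:
  "s \<in> {1, -1} \<Longrightarrow> pauli1 *\<^sub>v vec_of_list [1, s] = s \<cdot>\<^sub>v vec_of_list [1, s]"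
  "t \<in> {1, -1} \<Longrightarrow> pauli2 *\<^sub>v vec_of_list [1, t * \<i>] = t \<cdot>\<^sub>v vec_of_list [1, t * \<i>]"
  "pauli3 *\<^sub>v vec_of_list [1, 0] = 1 \<cdot>\<^sub>v vec_of_list [1, 0]"
  by (rule eq_vecI;
      force simp: scalar_prod_def sum_atLeast0_lessThan_2 vec_of_list_index less_Suc_eq)+

section \<open>Pauli strings and their anticommutation\<close>

lemma pauli_string_Suc_1: "pauli_string (Suc n) (Suc 0) S = kron S (1\<^sub>m (2 ^ n))"
  \<comment> \<open>The empty power of \<open>pauli1\<close> is the 1 by 1 identity, which is
    dropped; \<open>simplified\<close> rewrites its size to \<open>Suc 0\<close>, the form met
    here.\<close>
  unfolding pauli_string_def by (simp add: kron_one_left[simplified] kron_pow_one)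

text \<open>This recursion drives the inductions on \<open>n\<close>. The bound on \<open>j\<close>
  matters because subtraction truncates: at \<open>j = 0\<close> the left side would have no leading
  \<open>pauli1\<close>.\<close>

lemma pauli_string_Suc_Suc:
  "1 \<le> j \<Longrightarrow> pauli_string (Suc n) (Suc j) S = kron pauli1 (pauli_string n j S)"
  unfolding pauli_string_def by (cases j) (simp_all add: kron_assoc)

lemma pauli_string_carrier_mat:
  assumes "j \<in> {1..n}" "S \<in> carrier_mat 2 2"
  shows "pauli_string n j S \<in> carrier_mat (2 ^ n) (2 ^ n)"
  using assms(1)
proof (induction n arbitrary: j)
  case (Suc n)
  show ?case
  proof (cases "j = 1")
    case True
    then show ?thesis using assms by (auto simp: pauli_string_Suc_1)
  next
    case False
    then obtain i where i: "j = Suc i" "i \<in> {1..n}" using Suc.prems by (cases j) auto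
    then show ?thesis using Suc.IH[of i] by (auto simp: pauli_string_Suc_Suc)
  qed
qed auto

lemma hermitian_pauli_string: "hermitian S \<Longrightarrow> hermitian (pauli_string n j S)"
  unfolding pauli_string_def
  by (intro hermitian_kron hermitian_kron_pow hermitian_pauli hermitian_one)

lemma anticommute_sym:
  assumes "A \<in> carrier_mat n n" "B \<in> carrier_mat n n" "A * B = - (B * A :: 'a :: comm_ring_1 mat)"
  shows "B * A = - (A * B)"
  using assms by (auto intro!: eq_matI)

text \<open>Induction on \<open>n\<close>, comparing first tensor factors. If both strings start
  with their special matrix, \<open>S\<close> and \<open>T\<close> supply the sign; if only one
  does, its matrix meets \<open>pauli1\<close> there and supplies the sign, while the tails commute
  because one is the identity; if neither does, \<open>pauli1\<close> meets itself and the sign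
  comes from the tails.\<close>

lemma pauli_string_anticommute:
  assumes S: "S \<in> carrier_mat 2 2" "S * pauli1 = - (pauli1 * S)"
    and T: "T \<in> carrier_mat 2 2" "T * pauli1 = - (pauli1 * T)"
    and "j \<in> {1..n}" "k \<in> {1..n}" "j = k \<Longrightarrow> S * T = - (T * S)"
  shows "pauli_string n j S * pauli_string n k T = - (pauli_string n k T * pauli_string n j S)"
  using assms(5-)
proof (induction n arbitrary: j k)
  case (Suc n)
  let ?I = "1\<^sub>m (2 ^ n) :: complex mat"
  have I: "?I \<in> carrier_mat (2 ^ n) (2 ^ n)" by simp
  have split: "a = 1 \<or> (\<exists>i. a = Suc i \<and> i \<in> {1..n})" if "a \<in> {1..Suc n}" for a
    using that by (cases a) auto
  consider "j = 1" "k = 1" | i where "j = Suc i" "i \<in> {1..n}" "k = 1"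
    | l where "k = Suc l" "l \<in> {1..n}" "j = 1"
    | i l where "j = Suc i" "i \<in> {1..n}" "k = Suc l" "l \<in> {1..n}"
    using split[OF Suc.prems(1)] split[OF Suc.prems(2)] by blast
  then show ?case
  proof cases
    case 1
    then show ?thesis
      using Suc.prems kron_mult_kron[OF S(1) I T(1) I] kron_mult_kron[OF T(1) I S(1) I]
      by (simp add: pauli_string_Suc_1 kron_uminus_left)
  next
    case (2 i)
    have P: "pauli_string n i S \<in> carrier_mat (2 ^ n) (2 ^ n)" (is "?P \<in> _")
      using 2 S by (intro pauli_string_carrier_mat)
    have "pauli1 * T = - (T * pauli1)" using anticommute_sym[OF T(1) _ T(2)] by simp
    then show ?thesis
      using 2 P kron_mult_kron[OF pauli_carrier_mat(1) P T(1) I]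
        kron_mult_kron[OF T(1) I pauli_carrier_mat(1) P]
      by (simp add: pauli_string_Suc_1 pauli_string_Suc_Suc kron_uminus_left)
  next
    case (3 l)
    have P: "pauli_string n l T \<in> carrier_mat (2 ^ n) (2 ^ n)" (is "?P \<in> _")
      using 3 T by (intro pauli_string_carrier_mat)
    show ?thesis
      using 3 P S(2) kron_mult_kron[OF pauli_carrier_mat(1) P S(1) I]
        kron_mult_kron[OF S(1) I pauli_carrier_mat(1) P]
      by (simp add: pauli_string_Suc_1 pauli_string_Suc_Suc kron_uminus_left)
  next
    case (4 i l)
    have P: "pauli_string n i S \<in> carrier_mat (2 ^ n) (2 ^ n)"
      and Q: "pauli_string n l T \<in> carrier_mat (2 ^ n) (2 ^ n)"
      using 4 S T by (auto intro: pauli_string_carrier_mat)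
    have "pauli_string n i S * pauli_string n l T = - (pauli_string n l T * pauli_string n i S)"
      using 4 Suc by auto
    then show ?thesis
      using 4 kron_mult_kron[OF pauli_carrier_mat(1) P pauli_carrier_mat(1) Q]
        kron_mult_kron[OF pauli_carrier_mat(1) Q pauli_carrier_mat(1) P]
      by (simp add: pauli_string_Suc_Suc kron_uminus_right)
  qed
qed auto

section \<open>The generators as Hermitian, pairwise anticommuting matrices\<close>

lemma Gamma_cases:
  assumes "a \<in> {1..2 * n}"
  obtains j where "a = j" "j \<in> {1..n}" "Gamma n a = pauli_string n j pauli2"
    | j where "a = n + j" "j \<in> {1..n}" "Gamma n a = pauli_string n j pauli3"
proof (cases "a \<le> n")
  case True
  then show ?thesis using assms that(1)[of a] by (auto simp: Gamma_def)
next
  case False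
  then have "a = n + (a - n)" "a - n \<in> {1..n}" "Gamma n a = pauli_string n (a - n) pauli3"
    using assms by (auto simp: Gamma_def)
  then show ?thesis by (rule that(2))
qed

lemma hermitian_Gamma: "hermitian (Gamma n a)"
  by (simp add: Gamma_def hermitian_pauli_string hermitian_pauli)

lemma Gamma_anticommute:
  assumes a: "a \<in> {1..2 * n}" and b: "b \<in> {1..2 * n}" and "a \<noteq> b"
  shows "Gamma n a * Gamma n b = - (Gamma n b * Gamma n a)"
proof -
  note anti = pauli_string_anticommute pauli_anticommute pauli_carrier_mat
  \<comment> \<open>When \<open>a > n\<close> and \<open>b \<le> n\<close>, the two strings may have
    their special matrices in the same slot, and \<open>pauli3\<close> then stands on the
    left.\<close>
  have 23: "pauli3 * pauli2 = - (pauli2 * pauli3)"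
    using anticommute_sym[OF pauli_carrier_mat(2,3) pauli_anticommute(3)] .
  show ?thesis
  proof (cases rule: Gamma_cases[OF a])
    case j: (1 j)
    show ?thesis
    proof (cases rule: Gamma_cases[OF b])
      case (1 k)
      \<comment> \<open>Both generators are of the same kind, so \<open>a \<noteq> b\<close> forces
        different slots and the condition for equal slots is vacuous.\<close>
      then show ?thesis using j \<open>a \<noteq> b\<close> by (simp only:) (rule anti, (rule anti | blast)+)
    next
      case (2 k)
      then show ?thesis using j by (simp only:) (rule anti, (rule anti | blast)+)
    qed
  next
    case j: (2 j)
    show ?thesis
    proof (cases rule: Gamma_cases[OF b])
      case (1 k)
      then show ?thesis using j 23 by (simp only:) (rule anti, (rule anti | blast)+)
    next
      case (2 k)
      then show ?thesis using j \<open>a \<noteq> b\<close> by (simp only:) (rule anti, (rule anti | blast)+)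
    qed
  qed
qed

text \<open>Since any eigenvector with real eigenvalue is covered, the existence claim and the
  orthogonality for both explicit families all follow from this one fact.\<close>

lemma Gamma_eigenvector_orthogonal:
  assumes "j \<in> {1..2 * n}" "i \<in> {1..2 * n}" "i \<noteq> j" "eigenvector (Gamma n j) v k" "cnj k = k"
  shows "((Gamma n i * Gamma n j) *\<^sub>v v) \<bullet>c v = 0"
  using assms
  by (intro anticommuting_hermitian_orthogonal[OF Gamma_carrier hermitian_Gamma Gamma_carrier
        Gamma_anticommute])

section \<open>The explicit eigenvectors\<close>

text \<open>Treats both families at once: \<open>u\<close> is the vector in slot \<open>j\<close>
  and \<open>c\<close> the normalising factor. Each of the \<open>j - 1\<close> leading
  \<open>pauli1\<close> factors contributes \<open>s\<close> to the eigenvalue, \<open>S\<close>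
  contributes \<open>t\<close>, and the identities contribute 1.\<close>

lemma pauli_string_eigenvector:
  assumes j: "j \<in> {1..n}" and s: "s \<in> {1, -1}" and S: "S \<in> carrier_mat 2 2"
    and u: "u \<in> carrier_vec 2" "u $ 0 = 1" "S *\<^sub>v u = t \<cdot>\<^sub>v u" and c: "c \<noteq> 0"
  shows "eigenvector (pauli_string n j S)
    (c \<cdot>\<^sub>v kron_vec (kron_vec_pow (vec_of_list [1, s]) (j - 1))
       (kron_vec u (kron_vec_pow (vec_of_list [1, 0]) (n - j)))) (s ^ (j - 1) * t)"
    (is "eigenvector ?G (c \<cdot>\<^sub>v kron_vec ?x (kron_vec u ?y)) _")
proof -
  have x: "?x \<in> carrier_vec (2 ^ (j - 1))" and y: "?y \<in> carrier_vec (2 ^ (n - j))"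
    by (intro kron_vec_pow_carrier_vec vec_of_list_pair_carrier_vec)+
  have uy: "kron_vec u ?y \<in> carrier_vec (2 * 2 ^ (n - j))" using u y by blast
  have "2 ^ (j - 1) * (2 * 2 ^ (n - j)) = (2 :: nat) ^ (j - 1 + Suc (n - j))"
    by (simp add: power_add)
  also have "\<dots> = 2 ^ n" using j by (intro arg_cong[where f = "power 2"]) auto
  finally have v: "kron_vec ?x (kron_vec u ?y) \<in> carrier_vec (2 ^ n)"
    using kron_vec_carrier_vec[OF x uy] by simp
  have G: "?G \<in> carrier_mat (2 ^ n) (2 ^ n)" using j S by (rule pauli_string_carrier_mat)
  have Px: "kron_pow pauli1 (j - 1) *\<^sub>v ?x = s ^ (j - 1) \<cdot>\<^sub>v ?x"
    using s by (intro kron_pow_mult_kron_vec_pow[of _ 2] pauli_mult_vec vec_of_list_pair_carrier_vec) auto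
  have Iy: "kron_pow (1\<^sub>m 2) (n - j) *\<^sub>v ?y = ?y"
    using y by (simp add: kron_pow_one)
  have P: "kron_pow pauli1 (j - 1) \<in> carrier_mat (2 ^ (j - 1)) (2 ^ (j - 1))"
    and I: "(kron_pow (1\<^sub>m 2) (n - j) :: complex mat) \<in> carrier_mat (2 ^ (n - j)) (2 ^ (n - j))"
    by auto
  have "?G *\<^sub>v kron_vec ?x (kron_vec u ?y) = (s ^ (j - 1) * t) \<cdot>\<^sub>v kron_vec ?x (kron_vec u ?y)"
    unfolding pauli_string_def kron_mult_kron_vec[OF P kron_carrier_mat[OF S I] x uy]
      kron_mult_kron_vec[OF S I u(1) y] Px Iy u(3)
    by (simp add: kron_vec_smult_left kron_vec_smult_right smult_smult_assoc mult.commute)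
  then have "?G *\<^sub>v (c \<cdot>\<^sub>v kron_vec ?x (kron_vec u ?y))
      = (s ^ (j - 1) * t) \<cdot>\<^sub>v (c \<cdot>\<^sub>v kron_vec ?x (kron_vec u ?y))"
    using mult_mat_vec[OF G v] by (simp add: smult_smult_assoc mult.commute)
  \<comment> \<open>Every tensor factor has coordinate 0 equal to 1, so coordinate 0 of the scaled
    vector is \<open>c\<close>, which is nonzero.\<close>
  moreover have "c \<cdot>\<^sub>v kron_vec ?x (kron_vec u ?y) \<noteq> 0\<^sub>v (2 ^ n)"
  proof
    assume *: "c \<cdot>\<^sub>v kron_vec ?x (kron_vec u ?y) = 0\<^sub>v (2 ^ n)"
    have "(c \<cdot>\<^sub>v kron_vec ?x (kron_vec u ?y)) $ 0 = c * kron_vec ?x (kron_vec u ?y) $ 0"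
      using u by (intro index_smult_vec) auto
    also have "\<dots> = c" using u by (simp add: kron_vec_index_0 kron_vec_pow_index_0)
    finally show False using c * by simp
  qed
  ultimately show ?thesis using G v by (auto simp: eigenvector_def)
qed

lemma eigenvector_eigvec_pauli2:
  assumes "j \<in> {1..n}" "s \<in> {1, -1}" "t \<in> {1, -1}"
  shows "eigenvector (Gamma n j) (eigvec_pauli2 n j s t) (s ^ (j - 1) * t)"
proof -
  have G: "Gamma n j = pauli_string n j pauli2" using assms by (simp add: Gamma_def)
  show ?thesis unfolding eigvec_pauli2_def G using assms
    by (intro pauli_string_eigenvector pauli_mult_vec vec_of_list_pair_carrier_vec) auto
qed

lemma eigenvector_eigvec_pauli3:
  assumes "j \<in> {1..n}" "s \<in> {1, -1}"
  shows "eigenvector (Gamma n (n + j)) (eigvec_pauli3 n j s) (s ^ (j - 1))"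
proof -
  have "Gamma n (n + j) = pauli_string n j pauli3" using assms by (simp add: Gamma_def)
  moreover have "eigenvector (pauli_string n j pauli3) (eigvec_pauli3 n j s) (s ^ (j - 1) * 1)"
    \<comment> \<open>Of the \<open>n - j + 1\<close> copies of (1, 0), the first is split off as
      the vector in slot \<open>j\<close>, an eigenvector of \<open>pauli3\<close> with eigenvalue
      1; this is the explicit factor 1 in the eigenvalue.\<close>
    unfolding eigvec_pauli3_def Suc_eq_plus1[symmetric] kron_vec_pow.simps
    using assms
    by (intro pauli_string_eigenvector pauli_mult_vec vec_of_list_pair_carrier_vec) auto
  ultimately show ?thesis by simp
qed

theorem lemma1:
  fixes n :: nat
  shows
    "(\<forall>j\<in>{1..2 * n}. \<exists>v. (\<exists>k. eigenvector (Gamma n j) v k) \<and>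
        (\<forall>i\<in>{1..2 * n}. i \<noteq> j \<longrightarrow> ((Gamma n i * Gamma n j) *\<^sub>v v) \<bullet>c v = 0)) \<and>
     (\<forall>j\<in>{1..n}. \<forall>s\<in>{1, - 1}. \<forall>t\<in>{1, - 1}.
        eigenvector (Gamma n j) (eigvec_pauli2 n j s t) (s ^ (j - 1) * t) \<and>
        (\<forall>i\<in>{1..2 * n}. i \<noteq> j \<longrightarrow>
           ((Gamma n i * Gamma n j) *\<^sub>v eigvec_pauli2 n j s t) \<bullet>c eigvec_pauli2 n j s t = 0)) \<and>
     (\<forall>j\<in>{1..n}. \<forall>s\<in>{1, - 1}.
        eigenvector (Gamma n (n + j)) (eigvec_pauli3 n j s) (s ^ (j - 1)) \<and>
        (\<forall>i\<in>{1..2 * n}. i \<noteq> n + j \<longrightarrow>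
           ((Gamma n i * Gamma n (n + j)) *\<^sub>v eigvec_pauli3 n j s) \<bullet>c eigvec_pauli3 n j s = 0))"
proof (intro conjI ballI impI)
  fix j s t assume j: "j \<in> {1..n}" and st: "s \<in> {1, - 1 :: complex}" "t \<in> {1, - 1 :: complex}"
  show "eigenvector (Gamma n j) (eigvec_pauli2 n j s t) (s ^ (j - 1) * t)"
    using j st by (rule eigenvector_eigvec_pauli2)
  then show "((Gamma n i * Gamma n j) *\<^sub>v eigvec_pauli2 n j s t) \<bullet>c eigvec_pauli2 n j s t = 0"
    if "i \<in> {1..2 * n}" "i \<noteq> j" for i
    using that j st by (intro Gamma_eigenvector_orthogonal) auto
next
  fix j s assume j: "j \<in> {1..n}" and s: "s \<in> {1, - 1 :: complex}"
  show "eigenvector (Gamma n (n + j)) (eigvec_pauli3 n j s) (s ^ (j - 1))"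
    using j s by (rule eigenvector_eigvec_pauli3)
  then show "((Gamma n i * Gamma n (n + j)) *\<^sub>v eigvec_pauli3 n j s) \<bullet>c eigvec_pauli3 n j s = 0"
    if "i \<in> {1..2 * n}" "i \<noteq> n + j" for i
    using that j s by (intro Gamma_eigenvector_orthogonal) auto
next
  fix j assume j: "j \<in> {1..2 * n}"
  \<comment> \<open>Taking all signs equal to 1 in the explicit families gives eigenvalue 1, which
    is real as the orthogonality argument requires.\<close>
  have "\<exists>v. eigenvector (Gamma n j) v 1"
    using j
  proof (cases rule: Gamma_cases)
    case (1 i)
    then show ?thesis using eigenvector_eigvec_pauli2[of i n 1 1] by auto
  next
    case (2 i)
    then show ?thesis using eigenvector_eigvec_pauli3[of i n 1] by auto
  qed
  then show "\<exists>v. (\<exists>k. eigenvector (Gamma n j) v k) \<and>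
      (\<forall>i\<in>{1..2 * n}. i \<noteq> j \<longrightarrow> ((Gamma n i * Gamma n j) *\<^sub>v v) \<bullet>c v = 0)"
    using j Gamma_eigenvector_orthogonal by (metis complex_cnj_one)
qed

end
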